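(* Let $\mathcal{A}(\lambda)=A_0+\sum_{i=1}^m\lambda_iA_i$ with $A_i\in\mathbb{C}^{k\times\ell}$, $k=\ell+m-1$, define a (linear) rectangular multiparameter eigenvalue problem, let $E_0,\dots,E_m\in\mathbb{C}^{k\times\ell}$ be given error matrices, and let $\epsilon>0$. For $\tilde\lambda\in\mathbb{C}^m$ put $\tilde\gamma=\|E_0\|_2+\sum_{i=1}^m|\tilde\lambda_i|\,\|E_i\|_2$. Then each of the following sets is equal to the $\epsilon$-pseudospectrum $\Lambda_\epsilon(\mathcal{A}(\lambda))$: (i) $\{\tilde\lambda\in\mathbb{C}^m:\ \exists\,\tilde x\in\mathbb{C}^\ell\text{ with }\|\tilde x\|_2=1,\ \|\mathcal{A}(\tilde\lambda)\tilde x\|_2\le\epsilon\tilde\gamma\}$; (ii) $\{\tilde\lambda\in\mathbb{C}^m:\ \sigma_{\min}(\mathcal{A}(\tilde\lambda))\le\epsilon\tilde\gamma\}$; (iii) $\{\tilde\lambda\in\mathbb{C}^m:\ \|\mathcal{A}(\tilde\lambda)^\dagger\|_2\ge(\epsilon\tilde\gamma)^{-1}\}$.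
   Context: $\|\cdot\|_2$ denotes the Euclidean norm of vectors and the induced (spectral) norm of matrices; $\sigma_{\min}$ is the smallest ($\ell$-th) singular value of a $k\times\ell$ matrix; $M^\dagger$ is the Moore–Penrose pseudoinverse. Convention in (iii): $\|\mathcal{A}(\tilde\lambda)^\dagger\|_2$ is understood as $\sigma_{\min}(\mathcal{A}(\tilde\lambda))^{-1}$, equal to $+\infty$ when $\mathcal{A}(\tilde\lambda)$ does not have full column rank, and $(\epsilon\tilde\gamma)^{-1}=+\infty$ if $\tilde\gamma=0$. Rectangular multiparameter eigenvalue problem: $A_0,\dots,A_m\in\mathbb{C}^{k\times\ell}$, $k=\ell+m-1$, are such that $\mathcal{A}(\lambda)$ has full normal rank (rank $\ell$ at a generic $\lambda\in\mathbb{C}^m$). The $\epsilon$-pseudospectrum is $$\Lambda_\epsilon(\mathcal{A}(\lambda))=\Big\{\tilde\lambda\in\mathbb{C}^m:\ \exists\,\tilde x\in\mathbb{C}^\ell\setminus\{0\},\ \exists\,\Delta A_0,\dots,\Delta A_m\in\mathbb{C}^{k\times\ell},\ \Big(A_0+\Delta A_0+\sum_{i=1}^m\tilde\lambda_i(A_i+\Delta A_i)\Big)\tilde x=0,\ \|\Delta A_i\|_2\le\epsilon\|E_i\|_2,\ i=0,\dots,m\Big\}.$$ *)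

theory Defs
  imports "HOL-Analysis.Analysis"
begin

text \<open>A \<open>k \<times> l\<close> complex matrix has type \<^typ>\<open>complex^'l^'k\<close>. On \<^typ>\<open>complex^'n\<close> the library's
  \<^const>\<open>norm\<close> is the Euclidean norm, but on matrices it is the Frobenius norm, hence the
  following.\<close>

definition spectral_norm :: "complex^'l^'k \<Rightarrow> real" where
  "spectral_norm M = onorm ((*v) M)"

definition conj_transpose :: "complex^'l^'k \<Rightarrow> complex^'k^'l" where
  "conj_transpose M = (\<chi> i j. cnj (M $ j $ i))"

text \<open>Square roots of the eigenvalues of \<open>M\<^sup>* M\<close> (which are real and nonnegative). These are the
  \<open>l\<close> singular values of \<open>M\<close> when \<open>k \<ge> l\<close>; the smallest is then the \<open>l\<close>-th.\<close>

definition singular_values :: "complex^'l^'k \<Rightarrow> real set" where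
  "singular_values M =
    {s. 0 \<le> s \<and> (\<exists>v. v \<noteq> 0 \<and> (conj_transpose M ** M) *v v = complex_of_real (s\<^sup>2) *s v)}"

definition sigma_min :: "complex^'l^'k \<Rightarrow> real" where
  "sigma_min M = Min (singular_values M)"

definition is_pinv :: "complex^'l^'k \<Rightarrow> complex^'k^'l \<Rightarrow> bool" where
  "is_pinv M X \<longleftrightarrow>
     M ** X ** M = M \<and> X ** M ** X = X \<and>
     conj_transpose (M ** X) = M ** X \<and> conj_transpose (X ** M) = X ** M"

definition pinv :: "complex^'l^'k \<Rightarrow> complex^'k^'l" where
  "pinv M = (THE X. is_pinv M X)"

text \<open>The norm of the pseudoinverse, with value \<open>\<infinity>\<close> for matrices without full column rank;
  lemma \<open>pinv_norm_eq\<close> below shows that it always equals \<open>1 / \<sigma>\<^sub>m\<^sub>i\<^sub>n\<close>, with \<open>1 / 0 = \<infinity>\<close>.\<close>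

definition pinv_norm :: "complex^'l^'k \<Rightarrow> ereal" where
  "pinv_norm M = (if rank M = CARD('l) then ereal (spectral_norm (pinv M)) else \<infinity>)"

text \<open>The coefficients \<open>A\<^sub>1, \<dots>, A\<^sub>m\<close> are indexed by the finite type \<^typ>\<open>'m\<close>, with
  \<open>m = CARD('m)\<close>; \<open>A\<^sub>0\<close> is kept separate.\<close>

definition pencil ::
  "complex^'l^'k \<Rightarrow> ('m::finite \<Rightarrow> complex^'l^'k) \<Rightarrow> complex^'m \<Rightarrow> complex^'l^'k" where
  "pencil A0 A lam = A0 + (\<Sum>i\<in>UNIV. map_matrix ((*) (lam $ i)) (A i))"

definition normal_rank :: "complex^'l^'k \<Rightarrow> ('m::finite \<Rightarrow> complex^'l^'k) \<Rightarrow> nat" where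
  "normal_rank A0 A = Max (range (\<lambda>lam. rank (pencil A0 A lam)))"

definition pseudospectrum ::
  "real \<Rightarrow> complex^'l^'k \<Rightarrow> ('m::finite \<Rightarrow> complex^'l^'k) \<Rightarrow>
   complex^'l^'k \<Rightarrow> ('m \<Rightarrow> complex^'l^'k) \<Rightarrow> (complex^'m) set" where
  "pseudospectrum eps E0 E A0 A =
    {lam. \<exists>x D0 D. x \<noteq> 0 \<and>
       pencil (A0 + D0) (\<lambda>i. A i + D i) lam *v x = 0 \<and>
       spectral_norm D0 \<le> eps * spectral_norm E0 \<and>
       (\<forall>i. spectral_norm (D i) \<le> eps * spectral_norm (E i))}"

definition gamma_tilde ::
  "complex^'l^'k \<Rightarrow> ('m::finite \<Rightarrow> complex^'l^'k) \<Rightarrow> complex^'m \<Rightarrow> real" where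
  "gamma_tilde E0 E lam = spectral_norm E0 + (\<Sum>i\<in>UNIV. cmod (lam $ i) * spectral_norm (E i))"

lemma full_normal_rank_iff:
  "normal_rank (A0::complex^'l^'k) A = CARD('l) \<longleftrightarrow> (\<exists>lam. rank (pencil A0 A lam) = CARD('l))"
proof -
  have le: "rank (pencil A0 A lam) \<le> CARD('l)" for lam
    unfolding row_rank_def_gen using vec.dim_subset_UNIV[of "rows (pencil A0 A lam)"]
    by (simp add: vec.dimension_def card_cart_basis)
  have "finite (range (\<lambda>lam. rank (pencil A0 A lam)))"
    by (rule finite_subset[of _ "{..CARD('l)}"]) (use le in auto)
  then show ?thesis
    unfolding normal_rank_def using le by (subst Max_eq_iff) (auto simp: image_iff eq_commute)
qed

lemma inner_complex_vec: "(x::complex^'n) \<bullet> y = Re (\<Sum>i\<in>UNIV. x $ i * cnj (y $ i))"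
  by (simp add: inner_vec_def inner_complex_def Re_sum)

lemma inner_conj_transpose:
  fixes M :: "complex^'l^'k"
  shows "(M *v x) \<bullet> y = x \<bullet> (conj_transpose M *v y)"
proof -
  have "(\<Sum>i\<in>UNIV. (M *v x) $ i * cnj (y $ i)) = (\<Sum>i\<in>UNIV. \<Sum>j\<in>UNIV. M $ i $ j * x $ j * cnj (y $ i))"
    by (simp add: matrix_vector_mult_def sum_distrib_right)
  also have "\<dots> = (\<Sum>j\<in>UNIV. \<Sum>i\<in>UNIV. M $ i $ j * x $ j * cnj (y $ i))"
    by (rule sum.swap)
  also have "\<dots> = (\<Sum>j\<in>UNIV. x $ j * cnj ((conj_transpose M *v y) $ j))"
    by (simp add: matrix_vector_mult_def conj_transpose_def sum_distrib_left mult_ac)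
  finally show ?thesis by (simp add: inner_complex_vec)
qed

lemma conj_transpose_conj_transpose [simp]: "conj_transpose (conj_transpose M) = M"
  by (simp add: conj_transpose_def vec_eq_iff)

lemma conj_transpose_mult: "conj_transpose (M ** N) = conj_transpose N ** conj_transpose M"
  by (simp add: conj_transpose_def matrix_matrix_mult_def vec_eq_iff mult_ac)

lemma conj_transpose_mat1 [simp]: "conj_transpose (mat 1) = mat 1"
  by (auto simp: conj_transpose_def mat_def vec_eq_iff)

lemma linear_matrix_complex: "linear ((*v) (M::complex^'l^'k))"
proof (rule linearI)
  show "M *v (r *\<^sub>R x) = r *\<^sub>R (M *v x)" for r x
    by (simp add: matrix_vector_mult_def vec_eq_iff scaleR_sum_right)
qed (rule matrix_vector_right_distrib)

lemma bounded_linear_matrix_complex: "bounded_linear ((*v) (M::complex^'l^'k))"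
  by (rule linear_conv_bounded_linear[THEN iffD1, OF linear_matrix_complex])

lemma of_real_vector_smult: "complex_of_real r *s x = r *\<^sub>R x"
  by (simp add: vec_eq_iff complex_eq_iff)

lemma inner_gram:
  fixes M :: "complex^'l^'k"
  shows "x \<bullet> ((conj_transpose M ** M) *v y) = (M *v x) \<bullet> (M *v y)"
  by (metis inner_conj_transpose matrix_vector_mul_assoc)

lemma singular_valuesE:
  assumes "s \<in> singular_values (M::complex^'l^'k)"
  obtains v where "norm v = 1" "0 \<le> s" "\<And>x. (M *v x) \<bullet> (M *v v) = s\<^sup>2 * (x \<bullet> v)"
proof -
  from assms obtain v where v: "0 \<le> s" "v \<noteq> 0"
      "(conj_transpose M ** M) *v v = complex_of_real (s\<^sup>2) *s v"
    unfolding singular_values_def by blast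
  have e: "(M *v x) \<bullet> (M *v v) = s\<^sup>2 * (x \<bullet> v)" for x
    using inner_gram[of x M v] unfolding v(3) of_real_vector_smult by simp
  have "M *v ((1 / norm v) *\<^sub>R v) = (1 / norm v) *\<^sub>R (M *v v)"
    by (rule linear_scale[OF linear_matrix_complex])
  then show thesis using v e that[of "(1 / norm v) *\<^sub>R v"] by simp
qed

lemma singular_value_norm:
  assumes "s \<in> singular_values (M::complex^'l^'k)"
  obtains v where "norm v = 1" "norm (M *v v) = s"
proof -
  obtain v where v: "norm v = 1" "0 \<le> s" "\<And>x. (M *v x) \<bullet> (M *v v) = s\<^sup>2 * (x \<bullet> v)"
    using assms by (rule singular_valuesE) blast
  have "(norm (M *v v))\<^sup>2 = s\<^sup>2"
    using v(3)[of v] v(1) by (metis mult.right_neutral one_power2 power2_norm_eq_inner)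
  then show thesis using v that by (simp add: power2_eq_iff_nonneg)
qed

lemma finite_singular_values: "finite (singular_values (M::complex^'l^'k))"
proof -
  have "\<forall>s\<in>singular_values M. \<exists>v. norm v = 1 \<and> 0 \<le> s \<and> (\<forall>x. (M *v x) \<bullet> (M *v v) = s\<^sup>2 * (x \<bullet> v))"
    by (meson singular_valuesE)
  then obtain f where f: "\<And>s. s \<in> singular_values M \<Longrightarrow> norm (f s) = 1 \<and> 0 \<le> s \<and>
      (\<forall>x. (M *v x) \<bullet> (M *v f s) = s\<^sup>2 * (x \<bullet> f s))"
    by metis
  have orth: "f s \<bullet> f t = 0" if "s \<in> singular_values M" "t \<in> singular_values M" "s \<noteq> t" for s t
  proof -
    have "s\<^sup>2 * (f s \<bullet> f t) = t\<^sup>2 * (f s \<bullet> f t)"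
      using f[OF that(1)] f[OF that(2)] by (metis inner_commute)
    moreover have "s\<^sup>2 \<noteq> t\<^sup>2" using f[OF that(1)] f[OF that(2)] that(3) by (simp add: power2_eq_iff_nonneg)
    ultimately show ?thesis by auto
  qed
  have inj: "inj_on f (singular_values M)"
  proof (rule inj_onI, rule ccontr)
    fix s t assume st: "s \<in> singular_values M" "t \<in> singular_values M" "f s = f t" "s \<noteq> t"
    then have "f s \<bullet> f s = 0" using orth by metis
    then show False using f[OF st(1)] by auto
  qed
  have "pairwise orthogonal (f ` singular_values M)"
    unfolding pairwise_def orthogonal_def using orth by blast
  moreover have "0 \<notin> f ` singular_values M" using f by force
  ultimately have "independent (f ` singular_values M)"
    by (rule pairwise_orthogonal_independent)
  then have "finite (f ` singular_values M)" by (rule independent_imp_finite)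
  then show ?thesis using inj finite_imageD by blast
qed

lemma least_singular_value:
  fixes M :: "complex^'l^'k"
  obtains c where "c \<in> singular_values M" "\<And>x. c * norm x \<le> norm (M *v x)"
proof -
  have "compact (sphere (0::complex^'l) 1)" "sphere (0::complex^'l) 1 \<noteq> {}" by auto
  moreover have "continuous_on (sphere 0 1) (\<lambda>x. norm (M *v x))"
    by (intro continuous_on_norm linear_continuous_on bounded_linear_matrix_complex)
  ultimately obtain v where v: "v \<in> sphere 0 1" "\<And>x. x \<in> sphere 0 1 \<Longrightarrow> norm (M *v v) \<le> norm (M *v x)"
    using continuous_attains_inf[of "sphere 0 1" "\<lambda>x. norm (M *v x)"] by blast
  define c where "c = norm (M *v v)"
  have low: "c * norm x \<le> norm (M *v x)" for x
  proof (cases "x = 0")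
    case False
    then have "c \<le> norm (M *v ((1 / norm x) *\<^sub>R x))" unfolding c_def by (intro v(2)) simp
    also have "\<dots> = norm (M *v x) / norm x"
      by (simp add: linear_scale[OF linear_matrix_complex])
    finally show ?thesis using False by (simp add: field_simps)
  qed simp
  define w where "w = (conj_transpose M ** M) *v v - c\<^sup>2 *\<^sub>R v"
  have quad: "0 \<le> 2 * t * (w \<bullet> w) + t\<^sup>2 * ((norm (M *v w))\<^sup>2 - c\<^sup>2 * (norm w)\<^sup>2)" for t
  proof -
    have "(c * norm (v + t *\<^sub>R w))\<^sup>2 \<le> (norm (M *v (v + t *\<^sub>R w)))\<^sup>2"
      using low by (intro power_mono) (auto simp: c_def)
    then have "c\<^sup>2 * (norm (v + t *\<^sub>R w))\<^sup>2 \<le> (norm (M *v v + t *\<^sub>R (M *v w)))\<^sup>2"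
      by (simp add: power_mult_distrib matrix_vector_right_distrib linear_scale[OF linear_matrix_complex])
    moreover have "(norm (M *v v + t *\<^sub>R (M *v w)))\<^sup>2
        = c\<^sup>2 + 2 * t * ((M *v w) \<bullet> (M *v v)) + t\<^sup>2 * (norm (M *v w))\<^sup>2"
      unfolding power2_norm_eq_inner c_def
      by (simp add: inner_add_left inner_add_right inner_commute algebra_simps power2_eq_square)
    moreover have "(norm (v + t *\<^sub>R w))\<^sup>2 = 1 + 2 * t * (w \<bullet> v) + t\<^sup>2 * (norm w)\<^sup>2"
    proof -
      have "v \<bullet> v = 1" using v(1) by (simp add: norm_eq_1)
      then show ?thesis unfolding power2_norm_eq_inner
        by (simp add: inner_add_left inner_add_right inner_commute algebra_simps power2_eq_square)
    qed
    moreover have "w \<bullet> w = (M *v w) \<bullet> (M *v v) - c\<^sup>2 * (w \<bullet> v)"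
    proof -
      have "w \<bullet> w = w \<bullet> ((conj_transpose M ** M) *v v - c\<^sup>2 *\<^sub>R v)"
        by (simp only: w_def[symmetric])
      also have "\<dots> = (M *v w) \<bullet> (M *v v) - c\<^sup>2 * (w \<bullet> v)"
        by (simp add: inner_diff_right inner_gram)
      finally show ?thesis .
    qed
    ultimately have "c\<^sup>2 * (1 + 2 * t * (w \<bullet> v) + t\<^sup>2 * (norm w)\<^sup>2)
        \<le> c\<^sup>2 + 2 * t * (w \<bullet> w + c\<^sup>2 * (w \<bullet> v)) + t\<^sup>2 * (norm (M *v w))\<^sup>2"
      by simp
    then show ?thesis by (simp add: algebra_simps)
  qed
  have "w \<bullet> w = 0"
  proof (rule ccontr)
    assume "w \<bullet> w \<noteq> 0"
    then have p: "0 < w \<bullet> w" by simp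
    define q where "q = \<bar>(norm (M *v w))\<^sup>2 - c\<^sup>2 * (norm w)\<^sup>2\<bar> + 1"
    have q: "0 < q" "(norm (M *v w))\<^sup>2 - c\<^sup>2 * (norm w)\<^sup>2 \<le> q" unfolding q_def by auto
    define t where "t = - (w \<bullet> w) / q"
    have "0 \<le> 2 * t * (w \<bullet> w) + t\<^sup>2 * q"
      using quad[of t] mult_left_mono[OF q(2), of "t\<^sup>2"] by simp
    also have "\<dots> = - (w \<bullet> w)\<^sup>2 / q"
      using q(1) by (simp add: t_def power2_eq_square field_simps)
    also have "\<dots> < 0" using p q by simp
    finally show False by simp
  qed
  then have "(conj_transpose M ** M) *v v = complex_of_real (c\<^sup>2) *s v"
    unfolding of_real_vector_smult w_def by simp
  then have "c \<in> singular_values M"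
    unfolding singular_values_def using v(1) by (auto simp: c_def intro!: exI[of _ v])
  then show thesis using low that by blast
qed

lemma sigma_min_in: "sigma_min (M::complex^'l^'k) \<in> singular_values M"
  unfolding sigma_min_def
  by (rule Min_in[OF finite_singular_values]) (metis empty_iff least_singular_value)

lemma sigma_min_nonneg: "0 \<le> sigma_min (M::complex^'l^'k)"
  using sigma_min_in[of M] by (simp add: singular_values_def)

lemma sigma_min_le: "sigma_min (M::complex^'l^'k) * norm x \<le> norm (M *v x)"
proof -
  obtain c where c: "c \<in> singular_values M" "\<And>x. c * norm x \<le> norm (M *v x)"
    using least_singular_value[of M] by blast
  have "sigma_min M \<le> c"
    unfolding sigma_min_def using c(1) finite_singular_values by (rule Min_le[rotated])
  then have "sigma_min M * norm x \<le> c * norm x" by (rule mult_right_mono) simp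
  then show ?thesis using c(2)[of x] by simp
qed

lemma is_pinv_unique:
  assumes "is_pinv M X" "is_pinv M Y"
  shows "X = Y"
proof -
  note [simp] = matrix_mul_assoc[symmetric]
  have x: "M ** (X ** M) = M" "X ** (M ** X) = X" "conj_transpose (M ** X) = M ** X"
      "conj_transpose (X ** M) = X ** M"
    and y: "M ** (Y ** M) = M" "Y ** (M ** Y) = Y" "conj_transpose (M ** Y) = M ** Y"
      "conj_transpose (Y ** M) = Y ** M"
    using assms unfolding is_pinv_def by simp_all
  have "M ** X = (M ** Y) ** (M ** X)" by (metis matrix_mul_assoc y(1))
  then have "M ** X = (M ** X) ** (M ** Y)" by (metis conj_transpose_mult x(3) y(3))
  then have mx: "M ** X = M ** Y" by (metis matrix_mul_assoc x(1))
  have "X ** M = (X ** M) ** (Y ** M)" by (metis matrix_mul_assoc y(1))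
  then have "X ** M = (Y ** M) ** (X ** M)" by (metis conj_transpose_mult x(4) y(4))
  then have xm: "X ** M = Y ** M" by (metis matrix_mul_assoc x(1))
  show ?thesis by (metis matrix_mul_assoc x(2) y(2) mx xm)
qed

lemma full_column_rank_iff:
  "rank (M::complex^'l^'k) = CARD('l) \<longleftrightarrow> sigma_min M \<noteq> 0"
proof -
  have "rank M = CARD('l) \<longleftrightarrow> vec.span (rows M) = UNIV"
    unfolding row_rank_def_gen vec.dim_eq_full[symmetric] by (simp add: vec.dimension_def card_cart_basis)
  also have "\<dots> \<longleftrightarrow> (\<forall>x. M *v x = 0 \<longrightarrow> x = 0)"
    by (metis matrix_left_invertible_ker matrix_left_invertible_span_rows_gen)
  also have "\<dots> \<longleftrightarrow> sigma_min M \<noteq> 0"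
  proof
    assume inj: "\<forall>x. M *v x = 0 \<longrightarrow> x = 0"
    obtain v where "norm v = 1" "norm (M *v v) = sigma_min M"
      using sigma_min_in by (rule singular_value_norm)
    then show "sigma_min M \<noteq> 0" using inj by auto
  next
    assume "sigma_min M \<noteq> 0"
    then have "0 < sigma_min M" using sigma_min_nonneg[of M] by linarith
    then show "\<forall>x. M *v x = 0 \<longrightarrow> x = 0"
      by (metis sigma_min_le mult_pos_pos not_le norm_zero zero_less_norm_iff)
  qed
  finally show ?thesis .
qed

lemma pinv_full_column_rank:
  fixes M :: "complex^'l^'k"
  assumes "sigma_min M \<noteq> 0"
  shows "is_pinv M (pinv M)" "pinv M ** M = mat 1"
proof -
  let ?G = "conj_transpose M ** M"
  have pos: "0 < sigma_min M" using sigma_min_nonneg[of M] assms by linarith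
  have "x = 0" if "?G *v x = 0" for x
  proof -
    have "(norm (M *v x))\<^sup>2 = 0" using inner_gram[of x M x] that by (simp add: power2_norm_eq_inner)
    then show ?thesis using pos sigma_min_le[of M x] by (simp add: mult_le_0_iff)
  qed
  then obtain B where B: "B ** ?G = mat 1" by (metis matrix_left_invertible_ker)
  then have B': "?G ** B = mat 1" by (simp add: matrix_left_right_inverse)
  have "conj_transpose B ** ?G = mat 1"
    using arg_cong[OF B', of conj_transpose] by (simp add: conj_transpose_mult)
  then have BB: "conj_transpose B = B" by (metis B' matrix_mul_assoc matrix_mul_lid matrix_mul_rid)
  have XM: "(B ** conj_transpose M) ** M = mat 1" using B by (simp add: matrix_mul_assoc)
  have "is_pinv M (B ** conj_transpose M)"
    unfolding is_pinv_def XM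
    by (simp add: matrix_mul_assoc[symmetric] XM[simplified matrix_mul_assoc[symmetric]]
        conj_transpose_mult BB)
  then have *: "pinv M = B ** conj_transpose M"
    unfolding pinv_def by (blast intro: is_pinv_unique)
  show "is_pinv M (pinv M)" "pinv M ** M = mat 1"
    unfolding * by fact+
qed

lemma pinv_norm_eq: "pinv_norm (M::complex^'l^'k) = inverse (ereal (sigma_min M))"
proof (cases "sigma_min M = 0")
  case True
  then show ?thesis by (simp add: pinv_norm_def full_column_rank_iff)
next
  case False
  then have pos: "0 < sigma_min M" using sigma_min_nonneg[of M] by linarith
  let ?X = "pinv M"
  have X: "conj_transpose (M ** ?X) = M ** ?X" "M ** ?X ** M = M" "?X ** M = mat 1"
    using pinv_full_column_rank[OF False] by (auto simp: is_pinv_def)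
  have upper: "norm (?X *v y) \<le> (1 / sigma_min M) * norm y" for y
  proof -
    let ?p = "M *v (?X *v y)"
    have "?p \<bullet> ?p = y \<bullet> ?p"
      by (metis X(1,2) inner_conj_transpose matrix_vector_mul_assoc)
    also have "\<dots> \<le> norm y * norm ?p" by (rule norm_cauchy_schwarz)
    finally have "norm ?p * norm ?p \<le> norm y * norm ?p"
      by (simp add: power2_norm_eq_inner[symmetric] power2_eq_square)
    then have "norm ?p \<le> norm y" by (cases "norm ?p = 0") (auto simp: mult_le_cancel_right)
    then have "sigma_min M * norm (?X *v y) \<le> norm y" using sigma_min_le order_trans by blast
    then show ?thesis using pos by (simp add: field_simps)
  qed
  have "onorm ((*v) ?X) \<le> 1 / sigma_min M" using upper by (rule onorm_le)
  moreover have "1 / sigma_min M \<le> onorm ((*v) ?X)"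
  proof -
    obtain v where v: "norm v = 1" "norm (M *v v) = sigma_min M"
      using sigma_min_in by (rule singular_value_norm)
    have "?X *v (M *v v) = v" by (simp add: matrix_vector_mul_assoc X(3))
    then have "1 \<le> onorm ((*v) ?X) * sigma_min M"
      using onorm[OF bounded_linear_matrix_complex[of ?X], of "M *v v"] v by simp
    then show ?thesis using pos by (simp add: field_simps)
  qed
  ultimately show ?thesis using False
    by (simp add: pinv_norm_def full_column_rank_iff spectral_norm_def divide_inverse)
qed

end

theory Submission
  imports Defs
begin

text \<open>
  Write \<open>\<A>(\<lambda>)\<close> for the pencil and \<open>\<gamma> = \<parallel>E\<^sub>0\<parallel> + \<Sum>\<^sub>i |\<lambda>\<^sub>i| \<parallel>E\<^sub>i\<parallel>\<close>. The number \<open>\<epsilon>\<gamma>\<close> measures how far a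
  perturbation of admissible size can move \<open>\<A>(\<lambda>)\<close> at a fixed \<open>\<lambda>\<close>. The theorem holds because this
  bound is both valid and attained.

  Valid: if \<open>\<lambda>\<close> is in the pseudospectrum, with vector \<open>x\<close> and perturbations \<open>\<Delta>A\<^sub>i\<close>, then
  \<open>\<A>(\<lambda>) x = -(\<Delta>A\<^sub>0 + \<Sum>\<^sub>i \<lambda>\<^sub>i \<Delta>A\<^sub>i) x\<close> has norm at most \<open>\<epsilon>\<gamma>\<parallel>x\<parallel>\<close> by the triangle inequality
  (\<open>norm_pencil_mult_le\<close>). Since \<open>\<sigma>\<^sub>m\<^sub>i\<^sub>n\<close> bounds \<open>\<parallel>\<A>(\<lambda>) x\<parallel> / \<parallel>x\<parallel>\<close> from below, \<open>\<sigma>\<^sub>m\<^sub>i\<^sub>n \<le> \<epsilon>\<gamma>\<close>.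

  Attained: a unit vector \<open>x\<close> with residual \<open>r = \<A>(\<lambda>) x\<close>, \<open>\<parallel>r\<parallel> \<le> \<epsilon>\<gamma>\<close>, becomes an exact null vector
  after the rank-one matrix \<open>- r x\<^sup>*\<close> is added. This matrix has norm \<open>\<parallel>r\<parallel>\<close>. It can be split among
  \<open>\<Delta>A\<^sub>0, \<dots>, \<Delta>A\<^sub>m\<close> in proportion to \<open>\<parallel>E\<^sub>i\<parallel>\<close>, with unimodular factors that cancel the
  phases of the \<open>\<lambda>\<^sub>i\<close>, so no share exceeds its allowance (\<open>exists_perturbation_residual\<close>).

  The minimum of \<open>\<parallel>\<A>(\<lambda>) x\<parallel>\<close> over unit vectors is \<open>\<sigma>\<^sub>m\<^sub>i\<^sub>n\<close>, and \<open>\<parallel>\<A>(\<lambda>)\<^sup>\<dagger>\<parallel> = 1 / \<sigma>\<^sub>m\<^sub>i\<^sub>n\<close>, with \<open>1 / 0 = \<infinity>\<close>, which connects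
  the three descriptions with one another.
\<close>

lemma norm_vector_smult: "norm (c *s (v::complex^'n)) = cmod c * norm v"
  by (simp add: norm_vec_def norm_mult L2_set_right_distrib)

lemma matrix_mult_le_spectral_norm:
  "norm ((M::complex^'l^'k) *v x) \<le> spectral_norm M * norm x"
  unfolding spectral_norm_def by (rule onorm[OF bounded_linear_matrix_complex])

lemma map_matrix_times_mult_vec: "map_matrix ((*) c) (M::complex^'l^'k) *v x = c *s (M *v x)"
  by (simp add: map_matrix_def matrix_vector_mult_def vec_eq_iff sum_distrib_left mult_ac)

lemma sum_matrix_mult_vec:
  "(\<Sum>i\<in>I. (M i::complex^'l^'k)) *v x = (\<Sum>i\<in>I. M i *v x)"
  by (induction I rule: infinite_finite_induct) (auto simp: matrix_vector_mult_add_rdistrib)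

lemma pencil_mult_vec:
  "pencil A0 A lam *v x = A0 *v x + (\<Sum>i\<in>UNIV. lam $ i *s (A i *v x))"
  by (simp add: pencil_def matrix_vector_mult_add_rdistrib sum_matrix_mult_vec
      map_matrix_times_mult_vec)

lemma pencil_add_mult_vec:
  "pencil (A0 + D0) (\<lambda>i. A i + D i) lam *v x = pencil A0 A lam *v x + pencil D0 D lam *v x"
  by (simp add: pencil_mult_vec matrix_vector_mult_add_rdistrib vec.scale_right_distrib
      sum.distrib)

lemma norm_pencil_mult_le: "norm (pencil D0 D lam *v x) \<le> gamma_tilde D0 D lam * norm x"
proof -
  have "norm (pencil D0 D lam *v x)
      \<le> norm (D0 *v x) + (\<Sum>i\<in>UNIV. norm (lam $ i *s (D i *v x)))"
    unfolding pencil_mult_vec by (intro order_trans[OF norm_triangle_ineq] add_left_mono norm_sum)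
  also have "\<dots> \<le> spectral_norm D0 * norm x
      + (\<Sum>i\<in>UNIV. cmod (lam $ i) * (spectral_norm (D i) * norm x))"
    unfolding norm_vector_smult
    by (intro add_mono sum_mono mult_left_mono matrix_mult_le_spectral_norm) auto
  also have "\<dots> = gamma_tilde D0 D lam * norm x"
    by (simp add: gamma_tilde_def algebra_simps sum_distrib_left)
  finally show ?thesis .
qed

lemma gamma_tilde_mono:
  assumes "spectral_norm D0 \<le> eps * spectral_norm E0"
    and "\<And>i. spectral_norm (D i) \<le> eps * spectral_norm (E i)"
  shows "gamma_tilde D0 D lam \<le> eps * gamma_tilde E0 E lam"
proof -
  have "gamma_tilde D0 D lam
      \<le> eps * spectral_norm E0 + (\<Sum>i\<in>UNIV. cmod (lam $ i) * (eps * spectral_norm (E i)))"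
    unfolding gamma_tilde_def using assms by (intro add_mono sum_mono mult_left_mono) auto
  also have "\<dots> = eps * gamma_tilde E0 E lam"
    by (simp add: gamma_tilde_def distrib_left sum_distrib_left mult_ac)
  finally show ?thesis .
qed

lemma spectral_norm_nonneg: "0 \<le> spectral_norm M"
  unfolding spectral_norm_def by (rule onorm_pos_le[OF bounded_linear_matrix_complex])

text \<open>The witness is the rank-one matrix \<open>b x\<^sup>*\<close>; the Cauchy--Schwarz inequality bounds its norm.\<close>

lemma exists_matrix_minimal_norm:
  fixes x :: "complex^'l" and b :: "complex^'k"
  assumes "norm x = 1"
  obtains M :: "complex^'l^'k" where "M *v x = b" "spectral_norm M \<le> norm b"
proof -
  define M where "M = (\<chi> i j. b $ i * cnj (x $ j))"
  have M: "M *v y = (\<Sum>j\<in>UNIV. cnj (x $ j) * y $ j) *s b" for y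
    by (simp add: M_def matrix_vector_mult_def vec_eq_iff sum_distrib_left mult_ac)
  have "(\<Sum>j\<in>UNIV. cnj (x $ j) * x $ j) = complex_of_real (\<Sum>j\<in>UNIV. (cmod (x $ j))\<^sup>2)"
    by (simp add: mult.commute flip: complex_norm_square)
  also have "(\<Sum>j\<in>UNIV. (cmod (x $ j))\<^sup>2) = 1"
    using assms by (simp add: norm_vec_def L2_set_def)
  finally have "M *v x = b" by (simp add: M)
  moreover have "spectral_norm M \<le> norm b"
    unfolding spectral_norm_def
  proof (rule onorm_le)
    fix y
    have "cmod (\<Sum>j\<in>UNIV. cnj (x $ j) * y $ j) \<le> (\<Sum>j\<in>UNIV. \<bar>cmod (x $ j)\<bar> * \<bar>cmod (y $ j)\<bar>)"
      by (rule order_trans[OF norm_sum]) (simp add: norm_mult)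
    also have "\<dots> \<le> norm x * norm y" unfolding norm_vec_def by (rule L2_set_mult_ineq)
    finally have "cmod (\<Sum>j\<in>UNIV. cnj (x $ j) * y $ j) \<le> norm y" using assms by simp
    then show "norm (M *v y) \<le> norm b * norm y"
      by (simp add: M norm_vector_smult mult.commute mult_left_mono)
  qed
  ultimately show thesis using that by blast
qed

text \<open>The bound of \<open>norm_pencil_mult_le\<close> is attained: any residual of norm at most \<open>\<epsilon>\<gamma>\<close> is produced
  by admissible perturbations. The share of \<open>b\<close> given to \<open>D i\<close> is \<open>\<parallel>E\<^sub>i\<parallel> / \<gamma>\<close>, rotated against
  the phase of \<open>\<lambda>\<^sub>i\<close> so that the contributions add up without cancellation. When \<open>\<gamma> = 0\<close> the
  hypothesis forces \<open>b = 0\<close>, and division by zero makes all shares vanish as required.\<close>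

lemma exists_perturbation_residual:
  fixes x :: "complex^'l" and b :: "complex^'k" and E0 :: "complex^'l^'k"
    and E :: "'m::finite \<Rightarrow> complex^'l^'k"
  assumes "norm x = 1" and b: "norm b \<le> eps * gamma_tilde E0 E lam" and eps: "eps > 0"
  obtains D0 D where "pencil D0 D lam *v x = b"
    "spectral_norm D0 \<le> eps * spectral_norm E0"
    "\<And>i. spectral_norm (D i) \<le> eps * spectral_norm (E i)"
proof -
  define g where "g = gamma_tilde E0 E lam"
  define c where "c = (\<lambda>i. cnj (sgn (lam $ i)) * complex_of_real (spectral_norm (E i) / g))"
  have g: "0 \<le> g"
    unfolding g_def gamma_tilde_def by (intro add_nonneg_nonneg sum_nonneg mult_nonneg_nonneg
        spectral_norm_nonneg norm_ge_zero)
  have share: "norm (u *s b) \<le> eps * s" if "cmod u \<le> s / g" "0 \<le> s" for u s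
  proof -
    have "norm (u *s b) \<le> (s / g) * (eps * g)"
      unfolding norm_vector_smult using that b g by (intro mult_mono) (auto simp: g_def)
    also have "\<dots> \<le> eps * s" using that(2) eps by (cases "g = 0") auto
    finally show ?thesis .
  qed
  obtain D0 :: "complex^'l^'k" where D0: "D0 *v x = complex_of_real (spectral_norm E0 / g) *s b"
      "spectral_norm D0 \<le> norm (complex_of_real (spectral_norm E0 / g) *s b)"
    using exists_matrix_minimal_norm[OF assms(1)] by blast
  have "\<exists>M::complex^'l^'k. M *v x = c i *s b \<and> spectral_norm M \<le> norm (c i *s b)" for i
    using exists_matrix_minimal_norm[OF assms(1)] by metis
  then obtain D :: "'m \<Rightarrow> complex^'l^'k" where D: "\<And>i. D i *v x = c i *s b"
      "\<And>i. spectral_norm (D i) \<le> norm (c i *s b)"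
    by metis
  have "spectral_norm D0 \<le> eps * spectral_norm E0"
    using g by (intro order_trans[OF D0(2)] share) (auto simp: norm_divide spectral_norm_nonneg)
  moreover have "spectral_norm (D i) \<le> eps * spectral_norm (E i)" for i
    using g by (intro order_trans[OF D(2)] share)
      (auto simp: c_def norm_mult norm_divide norm_sgn spectral_norm_nonneg)
  moreover have "pencil D0 D lam *v x = b"
  proof -
    have phase: "z * cnj (sgn z) = complex_of_real (cmod z)" for z
      by (cases "z = 0") (auto simp: sgn_eq power2_eq_square simp flip: complex_norm_square)
    have rotated: "lam $ i * c i = complex_of_real (cmod (lam $ i) * spectral_norm (E i) / g)" for i
      unfolding c_def mult.assoc[symmetric] phase by simp
    have "pencil D0 D lam *v x
        = (complex_of_real (spectral_norm E0 / g) + (\<Sum>i\<in>UNIV. lam $ i * c i)) *s b"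
      by (simp add: pencil_mult_vec D0(1) D(1) vec.scale_left_distrib vec.scale_sum_left)
    also have "complex_of_real (spectral_norm E0 / g) + (\<Sum>i\<in>UNIV. lam $ i * c i)
        = complex_of_real (g / g)"
      unfolding rotated
      by (subst (3) g_def)
        (simp add: gamma_tilde_def add_divide_distrib sum_divide_distrib)
    also have "\<dots> *s b = b" using b by (cases "g = 0") (auto simp: g_def)
    finally show ?thesis .
  qed
  ultimately show thesis using that by blast
qed

lemma exists_unit_vector_iff_sigma_min_le:
  "(\<exists>x. norm x = 1 \<and> norm ((M::complex^'l^'k) *v x) \<le> d) \<longleftrightarrow> sigma_min M \<le> d"
proof
  assume "\<exists>x. norm x = 1 \<and> norm (M *v x) \<le> d"
  then show "sigma_min M \<le> d" by (metis mult.right_neutral order_trans sigma_min_le)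
next
  assume "sigma_min M \<le> d"
  then show "\<exists>x. norm x = 1 \<and> norm (M *v x) \<le> d"
    by (metis singular_value_norm[OF sigma_min_in])
qed

lemma mem_pseudospectrum_iff_sigma_min_le:
  assumes eps: "eps > 0"
  shows "lam \<in> pseudospectrum eps E0 E A0 A
    \<longleftrightarrow> sigma_min (pencil A0 A lam) \<le> eps * gamma_tilde E0 E lam"
proof
  assume "lam \<in> pseudospectrum eps E0 E A0 A"
  then obtain x D0 D where x: "x \<noteq> 0" "pencil (A0 + D0) (\<lambda>i. A i + D i) lam *v x = 0"
    and D: "spectral_norm D0 \<le> eps * spectral_norm E0"
      "\<And>i. spectral_norm (D i) \<le> eps * spectral_norm (E i)"
    unfolding pseudospectrum_def by blast
  have "pencil A0 A lam *v x = - (pencil D0 D lam *v x)"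
    using x(2) by (simp add: pencil_add_mult_vec eq_neg_iff_add_eq_0)
  then have "norm (pencil A0 A lam *v x) \<le> gamma_tilde D0 D lam * norm x"
    by (simp add: norm_pencil_mult_le)
  also have "\<dots> \<le> eps * gamma_tilde E0 E lam * norm x"
    by (intro mult_right_mono gamma_tilde_mono D) auto
  finally have "sigma_min (pencil A0 A lam) * norm x \<le> eps * gamma_tilde E0 E lam * norm x"
    using sigma_min_le order_trans by blast
  then show "sigma_min (pencil A0 A lam) \<le> eps * gamma_tilde E0 E lam" using x(1) by simp
next
  assume "sigma_min (pencil A0 A lam) \<le> eps * gamma_tilde E0 E lam"
  then obtain x where x: "norm x = 1" "norm (pencil A0 A lam *v x) \<le> eps * gamma_tilde E0 E lam"
    by (metis exists_unit_vector_iff_sigma_min_le)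
  then obtain D0 D where D: "pencil D0 D lam *v x = - (pencil A0 A lam *v x)"
      "spectral_norm D0 \<le> eps * spectral_norm E0"
      "\<And>i. spectral_norm (D i) \<le> eps * spectral_norm (E i)"
    using exists_perturbation_residual[OF x(1) _ eps, of "- (pencil A0 A lam *v x)"]
    by (metis norm_minus_cancel)
  have "x \<noteq> 0" using x(1) by auto
  moreover have "pencil (A0 + D0) (\<lambda>i. A i + D i) lam *v x = 0"
    by (simp add: pencil_add_mult_vec D(1))
  ultimately show "lam \<in> pseudospectrum eps E0 E A0 A"
    unfolding pseudospectrum_def using D(2,3) by blast
qed

text \<open>In the extended reals inversion is antitone on the whole of \<open>[0, \<infinity>]\<close>, so the case \<open>\<gamma> = 0\<close>
  obeys the same rule as the others.\<close>

lemma ereal_inverse_le_inverse_iff: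
  assumes "0 \<le> s" "0 \<le> d"
  shows "inverse (ereal d) \<le> inverse (ereal s) \<longleftrightarrow> s \<le> d"
  using assms by (cases "s = 0"; cases "d = 0") auto

theorem mainTheorem5:
  fixes A0 E0 :: "complex^'l^'k"
    and A E :: "'m::finite \<Rightarrow> complex^'l^'k"
    and eps :: real
  assumes dims: "CARD('k) = CARD('l) + CARD('m) - 1"
    and full_normal_rank: "normal_rank A0 A = CARD('l)"
    and eps_pos: "eps > 0"
  shows
    "{lam. \<exists>x. norm x = 1 \<and> norm (pencil A0 A lam *v x) \<le> eps * gamma_tilde E0 E lam}
       = pseudospectrum eps E0 E A0 A \<and>
     {lam. sigma_min (pencil A0 A lam) \<le> eps * gamma_tilde E0 E lam}
       = pseudospectrum eps E0 E A0 A \<and>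
     {lam. pinv_norm (pencil A0 A lam) \<ge> inverse (ereal (eps * gamma_tilde E0 E lam))}
       = pseudospectrum eps E0 E A0 A"
proof (intro conjI)
  show "{lam. \<exists>x. norm x = 1 \<and> norm (pencil A0 A lam *v x) \<le> eps * gamma_tilde E0 E lam}
       = pseudospectrum eps E0 E A0 A"
    by (simp add: set_eq_iff exists_unit_vector_iff_sigma_min_le
        mem_pseudospectrum_iff_sigma_min_le[OF eps_pos])
  show "{lam. sigma_min (pencil A0 A lam) \<le> eps * gamma_tilde E0 E lam}
       = pseudospectrum eps E0 E A0 A"
    by (simp add: set_eq_iff mem_pseudospectrum_iff_sigma_min_le[OF eps_pos])
  have "0 \<le> eps * gamma_tilde E0 E lam" for lam
    using eps_pos unfolding gamma_tilde_def
    by (intro mult_nonneg_nonneg add_nonneg_nonneg sum_nonneg spectral_norm_nonneg) auto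
  then show "{lam. pinv_norm (pencil A0 A lam) \<ge> inverse (ereal (eps * gamma_tilde E0 E lam))}
       = pseudospectrum eps E0 E A0 A"
    by (simp only: set_eq_iff mem_Collect_eq pinv_norm_eq ereal_inverse_le_inverse_iff
        sigma_min_nonneg mem_pseudospectrum_iff_sigma_min_le[OF eps_pos] simp_thms)
qed

end
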